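(* Let $q=p^l$ with $p$ prime. The self-dual $(2,1)$ convolutional codes over $\mathbb{F}_q$ are exactly the self-dual $(2,1)$ block codes. In particular, these are exactly the codes with a generator matrix of the form $(a\ \ b)$ with $a,b\in\mathbb{F}_q$ such that $a^2=-b^2$ in $\mathbb{F}_q$. Such a generator matrix exists if and only if $-1$ is a square in $\mathbb{F}_q$, i.e., if and only if $p\equiv 1 \bmod 4$, or $p=2$, or $l$ is even.
   Context: An $(n,k)$ convolutional code over $\mathbb{F}_q$ is an $\mathbb{F}_q[z]$-submodule $\mathcal{C}\subset\mathbb{F}_q[z]^n$ of rank $k$. A generator matrix of $\mathcal{C}$ is a matrix $G(z)\in\mathbb{F}_q[z]^{k\times n}$ whose rows form a basis of $\mathcal{C}$ (in particular it has rank $k$, so a generator matrix $(a\ \ b)$ is nonzero). The dual is $\mathcal{C}^\perp=\{f(z)\in\mathbb{F}_q[z]^n : f(z)c(z)^\top=0\ \forall c(z)\in\mathcal{C}\}$, and $\mathcal{C}$ is self-dual if $\mathcal{C}=\mathcal{C}^\perp$. An $(n,k)$ block code is a $k$-dimensional subspace $C\subset\mathbb{F}_q^n$; it is self-dual if it equals $\{x\in\mathbb{F}_q^n : xc^\top=0\ \forall c\in C\}$. A block code with generator matrix $G\in\mathbb{F}_q^{k\times n}$ is identified with the convolutional code having the constant matrix $G$ as generator matrix. *)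

theory Defs
  imports "HOL-Analysis.Analysis" "HOL-Computational_Algebra.Polynomial"
begin

text \<open>
  The library interprets \<open>*s\<close> as a vector space operation over fields only. Over a commutative ring
  we therefore use the notions of the locale \<^locale>\<open>module\<close> directly; the lemma below justifies this.
\<close>

lemma module_vector_scalar_mult:
  "module ((*s) :: 'r::comm_ring_1 \<Rightarrow> 'r ^ 'n \<Rightarrow> 'r ^ 'n)"
  by unfold_locales (vector algebra_simps)+

text \<open>
  The rank of a submodule is the maximal number of linearly independent elements in it;
  that submodules of \<open>F[z]\<^sup>n\<close> are free is not built in.
\<close>

definition has_rank :: "('r::comm_ring_1 ^ 'n) set \<Rightarrow> nat \<Rightarrow> bool" where
  "has_rank M k \<longleftrightarrow>
     (\<exists>B\<subseteq>M. finite B \<and> \<not> module.dependent (*s) B \<and> card B = k) \<and>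
     (\<forall>B\<subseteq>M. \<not> module.dependent (*s) B \<longrightarrow> finite B \<and> card B \<le> k)"

text \<open>Here \<open>n = CARD('n)\<close>.\<close>

definition convolutional_code :: "nat \<Rightarrow> ('a::field poly ^ 'n) set \<Rightarrow> bool" where
  "convolutional_code k C \<longleftrightarrow> module.subspace (*s) C \<and> has_rank C k"

definition block_code :: "nat \<Rightarrow> ('a::field ^ 'n) set \<Rightarrow> bool" where
  "block_code k C \<longleftrightarrow> vec.subspace C \<and> vec.dim C = k"

text \<open>
  The following three notions are used both over \<open>F[z]\<close> (convolutional codes) and over \<open>F\<close>
  (block codes). Injectivity in the first one ensures that the rows, as a family and not only
  as a set, form a basis.
\<close>

definition generator_matrix :: "'r::comm_ring_1 ^ 'n ^ 'k \<Rightarrow> ('r ^ 'n) set \<Rightarrow> bool" where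
  "generator_matrix G C \<longleftrightarrow>
     inj (\<lambda>i. row i G) \<and> \<not> module.dependent (*s) (rows G) \<and> module.span (*s) (rows G) = C"

definition dual_code :: "('r::comm_ring_1 ^ 'n) set \<Rightarrow> ('r ^ 'n) set" where
  "dual_code C = {f. \<forall>c\<in>C. (\<Sum>i\<in>UNIV. f $ i * c $ i) = 0}"

definition self_dual :: "('r::comm_ring_1 ^ 'n) set \<Rightarrow> bool" where
  "self_dual C \<longleftrightarrow> C = dual_code C"

definition const_matrix :: "'a::field ^ 'n ^ 'k \<Rightarrow> 'a poly ^ 'n ^ 'k" where
  "const_matrix G = map_matrix (\<lambda>a. [:a:]) G"

end

theory Submission
  imports Defs
begin

text \<open>
  If \<open>(f, g)\<close> is a nonzero word of a self-dual code, then \<open>f\<^sup>2 = -g\<^sup>2\<close>. Comparing leading coefficients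
  yields \<open>s \<in> F\<close> with \<open>s\<^sup>2 = -1\<close>, so that \<open>(f - s g) (f + s g) = 0\<close>, and hence \<open>(f, g)\<close> is a multiple
  of a constant vector \<open>(\<plusminus>s, 1)\<close>. This vector is orthogonal to the code, so it lies in the code and
  generates it. Whether \<open>-1\<close> is a square is decided by the order \<open>q - 1\<close> of the group of units.
\<close>

section \<open>Modules generated by one vector\<close>

lemma independent_singleton_iff:
  fixes v :: "'r::idom ^ 'n"
  shows "\<not> module.dependent (*s) {v} \<longleftrightarrow> v \<noteq> 0"
proof -
  interpret module "(*s) :: 'r \<Rightarrow> 'r ^ 'n \<Rightarrow> 'r ^ 'n" by (rule module_vector_scalar_mult)
  show ?thesis
  proof
    assume "v \<noteq> 0"
    then show "\<not> dependent {v}"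
      using dependent_finite[of "{v}"] by (auto simp: vec_eq_iff)
  qed (use dependent_zero in auto)
qed

text \<open>Any two multiples of \<open>v\<close> satisfy the relation
  \<open>t *s (r *s v) - r *s (t *s v) = 0\<close>, so no independent set of multiples has two
  elements.\<close>

lemma has_rank_1_range:
  fixes v :: "'r::idom ^ 'n"
  assumes "v \<noteq> 0"
  shows "has_rank (range (\<lambda>k. k *s v)) 1"
proof -
  interpret module "(*s) :: 'r \<Rightarrow> 'r ^ 'n \<Rightarrow> 'r ^ 'n" by (rule module_vector_scalar_mult)
  have "finite B \<and> card B \<le> 1" if B: "B \<subseteq> range (\<lambda>k. k *s v)" and indep: "\<not> dependent B" for B
  proof -
    have "x = y" if "x \<in> B" "y \<in> B" for x y
    proof (rule ccontr)
      assume "x \<noteq> y"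
      obtain r t where xy: "x = r *s v" "y = t *s v"
        using B \<open>x \<in> B\<close> \<open>y \<in> B\<close> by blast
      \<comment> \<open>The coefficients of that relation. Independence makes \<open>u x = t\<close>
        vanish, hence \<open>y = 0\<close>, and 0 lies in no independent set.\<close>
      define u where "u z = (if z = x then t else - r)" for z
      have "(\<Sum>z\<in>{x, y}. u z *s z) = t *s (r *s v) - r *s (t *s v)"
        using \<open>x \<noteq> y\<close> unfolding u_def xy by simp
      also have "\<dots> = 0"
        by (simp add: mult.commute)
      finally have "u x = 0"
        using independentD[OF indep, of "{x, y}" u x] that by simp
      then have "y = 0"
        using xy by (simp add: u_def)
      then show False
        using dependent_zero[of B] indep that by simp
    qed
    then have "B \<subseteq> {x}" if "x \<in> B" for x
      using that by blast
    then show ?thesis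
      by (metis card.empty card_mono card.insert empty_iff equals0I finite.emptyI finite.insertI
          finite_subset One_nat_def zero_le)
  qed
  moreover have "v \<in> range (\<lambda>k. k *s v)"
    by (rule image_eqI[of _ _ 1]) simp_all
  moreover have "\<not> dependent {v}"
    using assms independent_singleton_iff by blast
  ultimately show ?thesis
    unfolding has_rank_def by (intro conjI exI[of _ "{v}"]) auto
qed

lemma generator_matrix_single_row_iff:
  fixes G :: "'r::idom ^ 'n ^ 1"
  shows "generator_matrix G C \<longleftrightarrow> G $ 1 \<noteq> 0 \<and> C = range (\<lambda>k. k *s (G $ 1))"
proof -
  interpret module "(*s) :: 'r \<Rightarrow> 'r ^ 'n \<Rightarrow> 'r ^ 'n" by (rule module_vector_scalar_mult)
  have "rows G = {G $ 1}"
    by (simp add: rows_def row_def)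
  moreover have "inj (\<lambda>i. row i G)"
    by (rule injI) (metis UNIV_1 UNIV_I singletonD)
  ultimately show ?thesis
    unfolding generator_matrix_def using independent_singleton_iff span_singleton by auto
qed

lemma convolutional_code_1_range:
  fixes v :: "'a::field poly ^ 'n"
  assumes "v \<noteq> 0"
  shows "convolutional_code 1 (range (\<lambda>k. k *s v))"
proof -
  interpret module "(*s) :: 'a poly \<Rightarrow> 'a poly ^ 'n \<Rightarrow> 'a poly ^ 'n"
    by (rule module_vector_scalar_mult)
  show ?thesis
    unfolding convolutional_code_def
    using has_rank_1_range[OF assms] subspace_span[of "{v}"] by (simp add: span_singleton)
qed

lemma block_code_1_range:
  fixes v :: "'a::field ^ 'n"
  assumes "v \<noteq> 0"
  shows "block_code 1 (range (\<lambda>k. k *s v))"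
  unfolding block_code_def
  using vec.subspace_span[of "{v}"] vec.dim_span_eq_card_independent[of "{v}"] assms
  by (simp add: vec.span_singleton)

section \<open>Self-dual codes of length two\<close>

lemma self_dual_isotropic:
  fixes C :: "('r::comm_ring_1 ^ 2) set"
  assumes "self_dual C" "v \<in> C"
  shows "(v $ 1)\<^sup>2 = - ((v $ 2)\<^sup>2)"
proof -
  have "v \<in> dual_code C"
    using assms unfolding self_dual_def by simp
  then have "v $ 1 * v $ 1 + v $ 2 * v $ 2 = 0"
    using assms(2) by (auto simp: dual_code_def sum_2)
  then show ?thesis
    by (simp add: power2_eq_square eq_neg_iff_add_eq_0)
qed

text \<open>When \<open>v\<close> is isotropic and \<open>v $ 2\<close> is a unit, a vector
  orthogonal to \<open>v\<close> is determined by its second entry, which leaves only the multiples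
  of \<open>v\<close>. Domains cover both uses, over \<open>F[z]\<close> and over
  \<open>F\<close>.\<close>

lemma self_dual_range:
  fixes v :: "'r::idom ^ 2"
  assumes sq: "(v $ 1)\<^sup>2 = - ((v $ 2)\<^sup>2)" and unit: "v $ 2 dvd 1"
  shows "self_dual (range (\<lambda>k. k *s v))"
proof -
  obtain c where c: "1 = v $ 2 * c"
    using unit by (rule dvdE)
  have iso: "v $ 1 * v $ 1 + v $ 2 * v $ 2 = 0"
    using sq by (simp add: power2_eq_square)
  have "k *s v \<in> dual_code (range (\<lambda>k. k *s v))" for k
  proof -
    have "k * v $ 1 * (m * v $ 1) + k * v $ 2 * (m * v $ 2) = 0" for m
      using iso by algebra
    then show ?thesis
      by (auto simp: dual_code_def sum_2)
  qed
  moreover have "f \<in> range (\<lambda>k. k *s v)" if "f \<in> dual_code (range (\<lambda>k. k *s v))" for f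
  proof -
    have "v \<in> range (\<lambda>k. k *s v)"
      by (rule image_eqI[of _ _ 1]) simp_all
    then have orth: "f $ 1 * v $ 1 + f $ 2 * v $ 2 = 0"
      using that unfolding dual_code_def sum_2 by blast
    \<comment> \<open>Multiplying \<open>orth\<close> by \<open>v $ 1\<close> and using
      \<open>iso\<close> gives \<open>f $ 1 * (v $ 2)^2 = f $ 2 * v $ 1 * v $ 2\<close>; multiplying
      by \<open>c\<close> twice removes the factors \<open>v $ 2\<close>.\<close>
    have "f $ 1 = f $ 2 * c * v $ 1"
      using orth iso c by algebra
    moreover have "f $ 2 = f $ 2 * c * v $ 2"
      using c by algebra
    ultimately have "f = (f $ 2 * c) *s v"
      by (simp add: vec_eq_iff forall_2)
    then show ?thesis
      by blast
  qed
  ultimately show ?thesis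
    unfolding self_dual_def by blast
qed

lemma poly_isotropic_proportional:
  fixes f g :: "'a::field poly"
  assumes sq: "f\<^sup>2 = - (g\<^sup>2)" and g: "g \<noteq> 0"
  obtains s where "s\<^sup>2 = -1" "f = [:s:] * g"
proof -
  define t where "t = lead_coeff f / lead_coeff g"
  have "(lead_coeff f)\<^sup>2 = lead_coeff (- (g\<^sup>2))"
    by (simp add: lead_coeff_power flip: sq)
  also have "\<dots> = - ((lead_coeff g)\<^sup>2)"
    by (simp only: lead_coeff_minus lead_coeff_power)
  finally have t: "t\<^sup>2 = -1"
    using g by (simp add: t_def power_divide)
  then have "[:t:] * [:t:] = - 1"
    by (simp add: power2_eq_square one_pCons)
  with sq have "(f - [:t:] * g) * (f + [:t:] * g) = 0"
    by algebra
  \<comment> \<open>Both \<open>t\<close> and \<open>- t\<close> are square roots of -1, so either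
    vanishing factor supplies \<open>s\<close>.\<close>
  then consider "f = [:t:] * g" | "f = [:- t:] * g"
    by (auto simp: eq_neg_iff_add_eq_0)
  then show ?thesis
    using t that[of t] that[of "- t"] by cases auto
qed

lemma self_dual_convolutional_code_generator:
  fixes C :: "('a::field poly ^ 2) set"
  assumes code: "convolutional_code 1 C" and sd: "self_dual C"
  obtains s where "s\<^sup>2 = -1" "C = range (\<lambda>k. k *s vector [[:s:], 1])"
proof -
  interpret module "(*s) :: 'a poly \<Rightarrow> 'a poly ^ 2 \<Rightarrow> 'a poly ^ 2"
    by (rule module_vector_scalar_mult)
  obtain B where B: "B \<subseteq> C" "\<not> dependent B" "card B = 1"
    using code unfolding convolutional_code_def has_rank_def by blast
  then obtain v where v: "v \<in> C" "v \<noteq> 0"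
    using dependent_zero by (metis card_1_singletonE insertI1 subsetD)
  have sq: "(v $ 1)\<^sup>2 = - ((v $ 2)\<^sup>2)"
    using self_dual_isotropic[OF sd v(1)] .
  have v2: "v $ 2 \<noteq> 0"
    using sq v(2) by (auto simp: vec_eq_iff forall_2)
  then obtain s where s: "s\<^sup>2 = -1" "v $ 1 = [:s:] * v $ 2"
    using poly_isotropic_proportional[OF sq] by blast
  let ?w = "vector [[:s:], 1] :: 'a poly ^ 2"
  have ss: "[:s:] * [:s:] = - 1"
    using s(1) by (simp add: power2_eq_square one_pCons)
  \<comment> \<open>Cancelling the common factor \<open>v $ 2\<close> turns orthogonality to
    \<open>v\<close> into orthogonality to the constant vector \<open>?w\<close>.\<close>
  have orth: "[:s:] * c $ 1 + c $ 2 = 0" if "c \<in> C" for c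
  proof -
    have "v \<in> dual_code C"
      using v(1) sd unfolding self_dual_def by simp
    then have "v $ 1 * c $ 1 + v $ 2 * c $ 2 = 0"
      using that by (auto simp: dual_code_def sum_2)
    then have "v $ 2 * ([:s:] * c $ 1 + c $ 2) = 0"
      unfolding s(2) by algebra
    then show ?thesis
      using v2 by simp
  qed
  have "?w \<in> dual_code C"
    using orth by (simp add: dual_code_def sum_2)
  then have "?w \<in> C"
    using sd unfolding self_dual_def by simp
  moreover have "subspace C"
    using code unfolding convolutional_code_def by simp
  ultimately have "range (\<lambda>k. k *s ?w) \<subseteq> C"
    by (auto simp: subspace_scale)
  moreover have "c \<in> range (\<lambda>k. k *s ?w)" if "c \<in> C" for c
  proof -
    \<comment> \<open>Multiply the orthogonality relation by \<open>[:s:]\<close>, whose square is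
      -1.\<close>
    have "c $ 1 = c $ 2 * [:s:]"
      using orth[OF that] ss by algebra
    then have "c = (c $ 2) *s ?w"
      unfolding vec_eq_iff forall_2 vector_smult_component vector_2 by simp
    then show ?thesis
      by blast
  qed
  ultimately show ?thesis
    using that s(1) by blast
qed

section \<open>Squares in finite fields\<close>

text \<open>Multiplication by \<open>x\<close> permutes the nonzero elements; their nonzero product
  can be cancelled.\<close>

lemma finite_field_power_card_minus_1:
  fixes x :: "'a::{field,finite}"
  assumes "x \<noteq> 0"
  shows "x ^ (CARD('a) - 1) = 1"
proof -
  have "(\<Prod>y\<in>UNIV - {0}. x * y) = (\<Prod>y\<in>UNIV - {0 :: 'a}. y)"
    by (rule prod.reindex_bij_betw[where h = "(*) x"],
        rule bij_betw_byWitness[where f' = "\<lambda>y. y / x"]) (use assms in auto)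
  then show ?thesis
    by (simp add: prod.distrib card_Diff_singleton)
qed

text \<open>Translation by 1 permutes the ring, so summing over all elements before and after gives
  the same value.\<close>

lemma of_nat_CARD_eq_0: "of_nat (CARD('a)) = (0 :: 'a::{ring_1,finite})"
proof -
  have "(\<Sum>x\<in>UNIV. x + 1) = (\<Sum>x\<in>UNIV. x :: 'a)"
    by (rule sum.reindex_bij_betw[where h = "\<lambda>x. x + 1"],
        rule bij_betw_byWitness[where f' = "\<lambda>x. x - 1"]) auto
  then show ?thesis
    by (simp add: sum.distrib)
qed

text \<open>For odd \<open>q = CARD('a)\<close>, a square root of -1 is a unit of order 4, and one
  exists exactly when 4 divides \<open>q - 1\<close>. It remains to reduce \<open>p ^ l\<close>
  modulo 4.\<close>

lemma finite_field_minus_1_square_iff: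
  fixes p l :: nat
  assumes p: "prime p" and q: "CARD('a::{field,finite}) = p ^ l"
  shows "(\<exists>x :: 'a. x\<^sup>2 = -1) \<longleftrightarrow> p mod 4 = 1 \<or> p = 2 \<or> even l"
proof (cases "p = 2")
  case True
  \<comment> \<open>A field has at least two elements; this rules out \<open>l = 0\<close>, so
    \<open>CARD('a)\<close> is even.\<close>
  have "card {0, 1 :: 'a} \<le> CARD('a)"
    by (rule card_mono) auto
  then have "odd (CARD('a) - 1)"
    using q True by (cases l) auto
  \<comment> \<open>Raising -1 to the odd power \<open>CARD('a) - 1\<close> gives both -1 and 1, so
    1 is itself a square root of -1.\<close>
  then have "(-1 :: 'a) = 1"
    using finite_field_power_card_minus_1[of "-1 :: 'a"] by simp
  then show ?thesis
    using True by (metis one_power2)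
next
  case False
  then have "odd p"
    using p primes_dvd_imp_eq two_is_prime_nat by blast
  then have p_mod: "p mod 4 = 1 \<or> p mod 4 = 3"
    by presburger
  have "odd (CARD('a))"
    using \<open>odd p\<close> q by simp
  have neg1: "(-1 :: 'a) \<noteq> 1"
  proof
    assume "(-1 :: 'a) = 1"
    then have "(1 :: 'a) + 1 = 0"
      by (metis add.left_inverse)
    \<comment> \<open>Even numbers vanish in the field, so the odd number \<open>CARD('a)\<close>
      would become 1 there, although it is 0.\<close>
    then have "of_nat (2 * (CARD('a) div 2)) = (0 :: 'a)"
      by (simp add: algebra_simps)
    moreover have "CARD('a) = 2 * (CARD('a) div 2) + 1"
      using \<open>odd (CARD('a))\<close> by simp
    ultimately have "of_nat (CARD('a)) = (1 :: 'a)"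
      by (metis add_0 of_nat_1 of_nat_add)
    then show False
      using of_nat_CARD_eq_0[where ?'a = 'a] by simp
  qed
  have "(\<exists>x :: 'a. x\<^sup>2 = -1) \<longleftrightarrow> CARD('a) mod 4 = 1"
  proof
    assume "\<exists>x :: 'a. x\<^sup>2 = -1"
    then obtain x :: 'a where x: "x\<^sup>2 = -1"
      by blast
    then have "x \<noteq> 0"
      by auto
    \<comment> \<open>Otherwise \<open>x ^ (CARD('a) - 1)\<close> would be an odd power of -1, hence
      -1 instead of 1.\<close>
    have "even ((CARD('a) - 1) div 2)"
    proof (rule ccontr)
      assume "odd ((CARD('a) - 1) div 2)"
      then have "(x\<^sup>2) ^ ((CARD('a) - 1) div 2) = -1"
        using x by simp
      moreover have "2 * ((CARD('a) - 1) div 2) = CARD('a) - 1"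
        using \<open>odd (CARD('a))\<close> by simp
      ultimately show False
        using finite_field_power_card_minus_1[OF \<open>x \<noteq> 0\<close>] neg1 by (simp flip: power_mult)
    qed
    then show "CARD('a) mod 4 = 1"
      using \<open>odd (CARD('a))\<close> by presburger
  next
    assume "CARD('a) mod 4 = 1"
    then have "CARD('a) = 4 * (CARD('a) div 4) + 1"
      by presburger
    then obtain m where m: "CARD('a) = 4 * m + 1"
      by blast
    have "card {0, 1 :: 'a} \<le> CARD('a)"
      by (rule card_mono) auto
    then have "m > 0"
      using m by simp
    \<comment> \<open>\<open>P\<close>, nonzero because \<open>m > 0\<close>, has at most
      \<open>2 * m\<close> roots among the \<open>4 * m\<close> nonzero elements. A nonzero non-root
      \<open>x\<close> has \<open>x ^ (2 * m)\<close> different from 1 but with square 1, so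
      \<open>x ^ m\<close> is the desired root of -1.\<close>
    define P :: "'a poly" where "P = monom 1 (2 * m) - 1"
    have "coeff P (2 * m) = 1"
      using \<open>m > 0\<close> by (simp add: P_def)
    then have "P \<noteq> 0"
      by force
    have "degree P \<le> 2 * m"
      unfolding P_def by (rule degree_diff_le) (simp_all add: degree_monom_le)
    then have "card {x. poly P x = 0} \<le> 2 * m"
      using card_poly_roots_bound[OF \<open>P \<noteq> 0\<close>] by linarith
    also have "\<dots> < card (UNIV - {0 :: 'a})"
      using m \<open>m > 0\<close> by (simp add: card_Diff_singleton)
    finally have "\<not> UNIV - {0} \<subseteq> {x. poly P x = 0}"
      by (meson card_mono finite leD)
    then obtain x :: 'a where x: "x \<noteq> 0" "x ^ (2 * m) \<noteq> 1"
      by (auto simp: P_def poly_monom)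
    have "(x ^ (2 * m))\<^sup>2 = x ^ (CARD('a) - 1)"
      by (simp add: m flip: power_mult)
    then have "(x ^ (2 * m))\<^sup>2 = 1"
      using finite_field_power_card_minus_1[OF x(1)] by simp
    then have "x ^ (2 * m) = -1"
      using x(2) by (simp add: power2_eq_1_iff)
    then have "(x ^ m)\<^sup>2 = -1"
      by (simp add: mult.commute flip: power_mult)
    then show "\<exists>x :: 'a. x\<^sup>2 = -1"
      by blast
  qed
  \<comment> \<open>If \<open>p\<close> is 3 modulo 4, then its even powers are 1 and its odd powers
    are 3 modulo 4.\<close>
  also have "CARD('a) mod 4 = 1 \<longleftrightarrow> p mod 4 = 1 \<or> even l"
  proof (cases "p mod 4 = 1")
    case True
    then show ?thesis
      using power_mod[of p 4 l] q by simp
  next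
    case False
    then have p3: "p mod 4 = 3"
      using p_mod by simp
    then have "p\<^sup>2 mod 4 = 1"
      using power_mod[of p 4 2] by simp
    then have even_power: "p ^ (2 * k) mod 4 = 1" for k
      using power_mod[of "p\<^sup>2" 4 k] by (simp add: power_mult)
    moreover have "p ^ (2 * k + 1) mod 4 = 3" for k
      using mod_mult_eq[of p 4 "p ^ (2 * k)"] p3 even_power[of k] by simp
    ultimately show ?thesis
      using False q by (cases "even l") (auto elim!: evenE oddE)
  qed
  finally show ?thesis
    using False by simp
qed

section \<open>Self-dual convolutional and block codes\<close>

lemma const_matrix_vector_row:
  "const_matrix (vector [vector [a, b]] :: 'a::field ^ 2 ^ 1) $ 1 = vector [[:a:], [:b:]]"
  by (simp add: const_matrix_def map_matrix_def vec_eq_iff forall_2)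

lemma vector_pair_nonzero_iff: "(vector [a, b] :: 'r::zero ^ 2) \<noteq> 0 \<longleftrightarrow> a \<noteq> 0 \<or> b \<noteq> 0"
  by (simp add: vec_eq_iff forall_2)

text \<open>Being a generator matrix excludes \<open>a = b = 0\<close>, a solution of
  \<open>a\<^sup>2 = - (b\<^sup>2)\<close> that generates only the zero module.\<close>

lemma generator_matrix_const_pair_iff:
  fixes a b :: "'a::field"
  shows "generator_matrix (const_matrix (vector [vector [a, b]] :: 'a ^ 2 ^ 1)) C \<longleftrightarrow>
    (a \<noteq> 0 \<or> b \<noteq> 0) \<and> C = range (\<lambda>k. k *s vector [[:a:], [:b:]])"
  by (simp add: generator_matrix_single_row_iff const_matrix_vector_row vector_pair_nonzero_iff)

lemma self_dual_convolutional_code_iff: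
  fixes C :: "('a::field poly ^ 2) set"
  shows "convolutional_code 1 C \<and> self_dual C \<longleftrightarrow>
    (\<exists>a b. a\<^sup>2 = - (b\<^sup>2) \<and>
       generator_matrix (const_matrix (vector [vector [a, b]] :: 'a ^ 2 ^ 1)) C)"
proof
  assume "convolutional_code 1 C \<and> self_dual C"
  then obtain s where "s\<^sup>2 = -1" "C = range (\<lambda>k. k *s vector [[:s:], 1])"
    using self_dual_convolutional_code_generator by blast
  then show "\<exists>a b. a\<^sup>2 = - (b\<^sup>2) \<and>
      generator_matrix (const_matrix (vector [vector [a, b]] :: 'a ^ 2 ^ 1)) C"
    unfolding generator_matrix_const_pair_iff by (intro exI[of _ s] exI[of _ 1]) (simp add: one_pCons)
next
  assume "\<exists>a b. a\<^sup>2 = - (b\<^sup>2) \<and>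
      generator_matrix (const_matrix (vector [vector [a, b]] :: 'a ^ 2 ^ 1)) C"
  then obtain a b where ab: "a\<^sup>2 = - (b\<^sup>2)" "a \<noteq> 0 \<or> b \<noteq> 0"
    and C: "C = range (\<lambda>k. k *s vector [[:a:], [:b:]])"
    unfolding generator_matrix_const_pair_iff by blast
  \<comment> \<open>If \<open>b\<close> were 0, the equation would force \<open>a = 0\<close> too.
    As a nonzero constant, \<open>b\<close> is a unit of \<open>F[z]\<close>, as
    \<open>self_dual_range\<close> requires.\<close>
  then have "b \<noteq> 0"
    by auto
  then show "convolutional_code 1 C \<and> self_dual C"
    unfolding C using ab
    by (intro conjI convolutional_code_1_range self_dual_range)
      (simp_all add: vector_pair_nonzero_iff power2_eq_square is_unit_pCons_iff)
qed

text \<open>The row space is the only candidate for \<open>B\<close>. A nonzero isotropic row has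
  nonzero second entry, a unit of the field, so \<open>self_dual_range\<close> applies
  again.\<close>

lemma self_dual_block_code_generator_iff:
  fixes G :: "'a::field ^ 2 ^ 1"
  shows "(\<exists>B. block_code 1 B \<and> self_dual B \<and> generator_matrix G B) \<longleftrightarrow>
    G $ 1 \<noteq> 0 \<and> (G $ 1 $ 1)\<^sup>2 = - ((G $ 1 $ 2)\<^sup>2)"
proof
  assume "\<exists>B. block_code 1 B \<and> self_dual B \<and> generator_matrix G B"
  then have "self_dual (range (\<lambda>k. k *s (G $ 1)))" "G $ 1 \<noteq> 0"
    unfolding generator_matrix_single_row_iff by blast+
  moreover have "G $ 1 \<in> range (\<lambda>k. k *s (G $ 1))"
    by (rule image_eqI[of _ _ 1]) simp_all
  ultimately show "G $ 1 \<noteq> 0 \<and> (G $ 1 $ 1)\<^sup>2 = - ((G $ 1 $ 2)\<^sup>2)"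
    using self_dual_isotropic by blast
next
  assume G: "G $ 1 \<noteq> 0 \<and> (G $ 1 $ 1)\<^sup>2 = - ((G $ 1 $ 2)\<^sup>2)"
  then have "G $ 1 $ 2 \<noteq> 0"
    by (auto simp: vec_eq_iff forall_2)
  then have "self_dual (range (\<lambda>k. k *s (G $ 1)))"
    using G by (intro self_dual_range) (auto simp: dvd_field_iff)
  then show "\<exists>B. block_code 1 B \<and> self_dual B \<and> generator_matrix G B"
    using G block_code_1_range unfolding generator_matrix_single_row_iff by blast
qed

lemma self_dual_block_code_iff:
  fixes C :: "('a::field poly ^ 2) set"
  shows "(\<exists>(B :: ('a ^ 2) set) (G :: 'a ^ 2 ^ 1).
      block_code 1 B \<and> self_dual B \<and> generator_matrix G B \<and>
      generator_matrix (const_matrix G) C) \<longleftrightarrow>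
    (\<exists>a b. a\<^sup>2 = - (b\<^sup>2) \<and>
       generator_matrix (const_matrix (vector [vector [a, b]] :: 'a ^ 2 ^ 1)) C)"
    (is "?L \<longleftrightarrow> ?R")
proof -
  have "?L \<longleftrightarrow> (\<exists>G :: 'a ^ 2 ^ 1. (G $ 1 \<noteq> 0 \<and> (G $ 1 $ 1)\<^sup>2 = - ((G $ 1 $ 2)\<^sup>2)) \<and>
      generator_matrix (const_matrix G) C)"
    unfolding self_dual_block_code_generator_iff[symmetric] by blast
  also have "\<dots> \<longleftrightarrow> (\<exists>a b. ((vector [a, b] :: 'a ^ 2) \<noteq> 0 \<and> a\<^sup>2 = - (b\<^sup>2)) \<and>
      generator_matrix (const_matrix (vector [vector [a, b]] :: 'a ^ 2 ^ 1)) C)"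
  proof -
    \<comment> \<open>Every 1 by 2 matrix has the form \<open>vector [vector [a, b]]\<close>; the
      existential version comes from the universal rules applied to the negated predicate.\<close>
    have "(\<exists>G :: 'a ^ 2 ^ 1. P G) \<longleftrightarrow> (\<exists>a b. P (vector [vector [a, b]]))" for P
      using forall_vector_1[of "\<lambda>G. \<not> P G"] forall_vector_2[of "\<lambda>v. \<not> P (vector [v])"] by blast
    then show ?thesis
      by simp
  qed
  also have "\<dots> \<longleftrightarrow> ?R"
    by (simp only: generator_matrix_const_pair_iff vector_pair_nonzero_iff) blast
  finally show ?thesis .
qed

text \<open>The quotient \<open>a / b\<close> is a square root of -1; conversely a root
  \<open>x\<close> gives the pair \<open>(x, 1)\<close>.\<close>

lemma exists_isotropic_generator_iff:
  "(\<exists>(a :: 'a::field) b (C :: ('a poly ^ 2) set). a\<^sup>2 = - (b\<^sup>2) \<and>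
      generator_matrix (const_matrix (vector [vector [a, b]] :: 'a ^ 2 ^ 1)) C) \<longleftrightarrow>
    (\<exists>x :: 'a. x\<^sup>2 = -1)"
proof -
  have "\<exists>x :: 'a. x\<^sup>2 = -1" if "a\<^sup>2 = - (b\<^sup>2)" "a \<noteq> 0 \<or> b \<noteq> 0" for a b :: 'a
  proof -
    have "b \<noteq> 0"
      using that by auto
    then have "(a / b)\<^sup>2 = -1"
      using that by (simp add: power_divide)
    then show ?thesis
      by blast
  qed
  moreover have "\<exists>a b :: 'a. a\<^sup>2 = - (b\<^sup>2) \<and> (a \<noteq> 0 \<or> b \<noteq> 0)" if "x\<^sup>2 = -1" for x :: 'a
    using that by (intro exI[of _ x] exI[of _ 1]) simp
  ultimately have "(\<exists>a b :: 'a. a\<^sup>2 = - (b\<^sup>2) \<and> (a \<noteq> 0 \<or> b \<noteq> 0)) \<longleftrightarrow> (\<exists>x :: 'a. x\<^sup>2 = -1)"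
    by metis
  then show ?thesis
    by (simp add: generator_matrix_const_pair_iff)
qed

theorem theorem7:
  fixes p l :: nat
  assumes "prime p"
    and "CARD('a::{field,finite}) = p ^ l"
  shows "({C :: ('a poly ^ 2) set. convolutional_code 1 C \<and> self_dual C} =
           {C. \<exists>(B :: ('a ^ 2) set) (G :: 'a ^ 2 ^ 1).
                 block_code 1 B \<and> self_dual B \<and> generator_matrix G B \<and>
                 generator_matrix (const_matrix G) C}) \<and>
         ({C :: ('a poly ^ 2) set. convolutional_code 1 C \<and> self_dual C} =
           {C. \<exists>a b :: 'a. a\<^sup>2 = -(b\<^sup>2) \<and>
                 generator_matrix (const_matrix (vector [vector [a, b]] :: 'a ^ 2 ^ 1)) C}) \<and>
         ((\<exists>(a :: 'a) b (C :: ('a poly ^ 2) set). a\<^sup>2 = -(b\<^sup>2) \<and>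
             generator_matrix (const_matrix (vector [vector [a, b]] :: 'a ^ 2 ^ 1)) C) \<longleftrightarrow>
           (\<exists>x :: 'a. x\<^sup>2 = -1)) \<and>
         ((\<exists>x :: 'a. x\<^sup>2 = -1) \<longleftrightarrow> p mod 4 = 1 \<or> p = 2 \<or> even l)"
  by (simp only: self_dual_convolutional_code_iff self_dual_block_code_iff
      exists_isotropic_generator_iff finite_field_minus_1_square_iff[OF assms])

end
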